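(* Let $k$ be a field and let $\Delta$ be a matroid on $[n]$ with connected components $\Delta_{A_1},\ldots,\Delta_{A_d}$, where $A_i\subseteq[n]$ is the ground set of $\Delta_{A_i}$. Let $J=J(\Delta)\subseteq R=k[x_1,\ldots,x_n]$ be the cover ideal of $\Delta$. Then the symbolic Noether number of $J$ is $\max\{r(\Delta_{A_i}) : 1\le i\le d\}$, where $r(\Delta_{A_i})$ is the rank of the matroid $\Delta_{A_i}$.
   Context: A matroid on $[n]$ is identified with the simplicial complex whose facets are its bases (loops allowed). The cover ideal is $J(\Delta)=\bigcap_{F}(x_i: i\in F)$, intersection over the bases $F$ of $\Delta$. The direct sum of matroids $\Delta_1,\Delta_2$ on disjoint ground sets $A_1,A_2$ is the matroid on $A_1\cup A_2$ whose bases are the sets $F_1\cup F_2$ with $F_i$ a basis of $\Delta_i$. A matroid is disconnected if it is the direct sum of two matroids on nonempty ground sets, and connected otherwise; if $\Delta=\Delta_{A_1}\oplus\cdots\oplus\Delta_{A_d}$ with all $\Delta_{A_i}$ connected, these are the connected components of $\Delta$. For a squarefree monomial ideal $J$, $J^{(\ell)}=\bigcap_{\mathfrak p\in\operatorname{Ass}(R/J)}\mathfrak p^\ell$ and the symbolic Rees algebra is $\mathcal R_s(J)=\bigoplus_{\ell\ge0}J^{(\ell)}t^\ell\subseteq R[t]$ (with $J^{(0)}=R$), which is a finitely generated $R$-algebra. The symbolic Noether number of $J$ (also called the symbolic Noether number of $\mathcal R_s(J)$) is the largest $t$-degree of a minimal $R$-algebra generator of $\mathcal R_s(J)$, i.e.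 the smallest $d\ge0$ such that $\mathcal R_s(J)$ is generated as an $R$-algebra by elements of $t$-degree at most $d$. *)

theory Defs
  imports "HOL-Library.Poly_Mapping" "HOL-Library.Disjoint_Sets"
    "HOL-Computational_Algebra.Polynomial"
begin

text \<open>A matroid is the complex \<open>\<Delta>\<close> of its independent sets together with its ground set \<open>E\<close>.
  The ground set has to be recorded because of loops: these belong to \<open>E\<close> but to no face.\<close>

locale matroid =
  fixes E :: "'v set" and \<Delta> :: "'v set set"
  assumes finite_ground: "finite E"
    and faces_subset: "\<Delta> \<subseteq> Pow E"
    and empty_face: "{} \<in> \<Delta>"
    and face_mono: "S \<in> \<Delta> \<Longrightarrow> T \<subseteq> S \<Longrightarrow> T \<in> \<Delta>"
    and augmentation: "S \<in> \<Delta> \<Longrightarrow> T \<in> \<Delta> \<Longrightarrow> card S < card T \<Longrightarrow> \<exists>x\<in>T - S. insert x S \<in> \<Delta>"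

definition bases :: "'v set set \<Rightarrow> 'v set set"
  where "bases \<Delta> = {F \<in> \<Delta>. \<forall>G\<in>\<Delta>. F \<subseteq> G \<longrightarrow> F = G}"

text \<open>The rank is the common cardinality of the bases.\<close>

definition matroid_rank :: "'v set set \<Rightarrow> nat"
  where "matroid_rank \<Delta> = (THE r. card ` bases \<Delta> = {r})"

definition is_direct_sum ::
    "'v set \<Rightarrow> 'v set set \<Rightarrow> 'v set \<Rightarrow> 'v set set \<Rightarrow> 'v set \<Rightarrow> 'v set set \<Rightarrow> bool"
  where "is_direct_sum E \<Delta> A\<^sub>1 \<Delta>\<^sub>1 A\<^sub>2 \<Delta>\<^sub>2 \<longleftrightarrow>
    matroid E \<Delta> \<and> matroid A\<^sub>1 \<Delta>\<^sub>1 \<and> matroid A\<^sub>2 \<Delta>\<^sub>2 \<and>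
    A\<^sub>1 \<inter> A\<^sub>2 = {} \<and> E = A\<^sub>1 \<union> A\<^sub>2 \<and>
    bases \<Delta> = {F\<^sub>1 \<union> F\<^sub>2 | F\<^sub>1 F\<^sub>2. F\<^sub>1 \<in> bases \<Delta>\<^sub>1 \<and> F\<^sub>2 \<in> bases \<Delta>\<^sub>2}"

definition disconnected_matroid :: "'v set \<Rightarrow> 'v set set \<Rightarrow> bool"
  where "disconnected_matroid E \<Delta> \<longleftrightarrow>
    (\<exists>A\<^sub>1 \<Delta>\<^sub>1 A\<^sub>2 \<Delta>\<^sub>2. is_direct_sum E \<Delta> A\<^sub>1 \<Delta>\<^sub>1 A\<^sub>2 \<Delta>\<^sub>2 \<and> A\<^sub>1 \<noteq> {} \<and> A\<^sub>2 \<noteq> {})"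

definition connected_matroid :: "'v set \<Rightarrow> 'v set set \<Rightarrow> bool"
  where "connected_matroid E \<Delta> \<longleftrightarrow> matroid E \<Delta> \<and> \<not> disconnected_matroid E \<Delta>"

definition is_direct_sum_family ::
    "'v set \<Rightarrow> 'v set set \<Rightarrow> 'i set \<Rightarrow> ('i \<Rightarrow> 'v set) \<Rightarrow> ('i \<Rightarrow> 'v set set) \<Rightarrow> bool"
  where "is_direct_sum_family E \<Delta> I A D \<longleftrightarrow>
    matroid E \<Delta> \<and> (\<forall>i\<in>I. matroid (A i) (D i)) \<and>
    disjoint_family_on A I \<and> E = (\<Union>i\<in>I. A i) \<and>
    bases \<Delta> = {(\<Union>i\<in>I. F i) | F. \<forall>i\<in>I. F i \<in> bases (D i)}"

text \<open>The empty matroid is connected according to \<^const>\<open>connected_matroid\<close>, so members with empty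
  ground set are not excluded here; they have rank 0.\<close>

definition connected_components ::
    "'v set \<Rightarrow> 'v set set \<Rightarrow> 'i set \<Rightarrow> ('i \<Rightarrow> 'v set) \<Rightarrow> ('i \<Rightarrow> 'v set set) \<Rightarrow> bool"
  where "connected_components E \<Delta> I A D \<longleftrightarrow>
    is_direct_sum_family E \<Delta> I A D \<and> (\<forall>i\<in>I. connected_matroid (A i) (D i))"

text \<open>An ideal of a commutative ring is a submodule of the ring over itself.\<close>

lemma module_times: "module ((*) :: 'a::comm_ring_1 \<Rightarrow> 'a \<Rightarrow> 'a)"
  by unfold_locales (simp_all add: algebra_simps)

abbreviation is_ideal :: "'a::comm_ring_1 set \<Rightarrow> bool"
  where "is_ideal \<equiv> module.subspace (*)"

abbreviation ideal_gen :: "'a::comm_ring_1 set \<Rightarrow> 'a set"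
  where "ideal_gen \<equiv> module.span (*)"

definition prime_ideal :: "'a::comm_ring_1 set \<Rightarrow> bool"
  where "prime_ideal P \<longleftrightarrow>
    is_ideal P \<and> P \<noteq> UNIV \<and> (\<forall>a b. a * b \<in> P \<longrightarrow> a \<in> P \<or> b \<in> P)"

primrec ideal_power :: "'a::comm_ring_1 set \<Rightarrow> nat \<Rightarrow> 'a set"
  where
    "ideal_power I 0 = UNIV"
  | "ideal_power I (Suc l) = ideal_gen {a * b | a b. a \<in> I \<and> b \<in> ideal_power I l}"

text \<open>\<open>Ass(R/J)\<close>: the primes of \<open>R\<close> that are the annihilator of some element \<open>f + J\<close> of \<open>R/J\<close>.\<close>

definition associated_primes :: "'a::comm_ring_1 set \<Rightarrow> 'a set set"
  where "associated_primes J = {P. prime_ideal P \<and> (\<exists>f. P = {r. r * f \<in> J})}"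

definition symbolic_power :: "'a::comm_ring_1 set \<Rightarrow> nat \<Rightarrow> 'a set"
  where "symbolic_power J l = (\<Inter>P\<in>associated_primes J. ideal_power P l)"

definition symbolic_rees :: "'a::comm_ring_1 set \<Rightarrow> 'a poly set"
  where "symbolic_rees J = {p. \<forall>l. coeff p l \<in> symbolic_power J l}"

inductive_set algebra_gen :: "'a::comm_ring_1 poly set \<Rightarrow> 'a poly set"
  for S :: "'a poly set"
  where
    const: "[:r:] \<in> algebra_gen S"
  | gen: "p \<in> S \<Longrightarrow> p \<in> algebra_gen S"
  | add: "p \<in> algebra_gen S \<Longrightarrow> q \<in> algebra_gen S \<Longrightarrow> p + q \<in> algebra_gen S"
  | mult: "p \<in> algebra_gen S \<Longrightarrow> q \<in> algebra_gen S \<Longrightarrow> p * q \<in> algebra_gen S"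

definition symbolic_noether_number :: "'a::comm_ring_1 set \<Rightarrow> nat"
  where "symbolic_noether_number J =
    (LEAST d. \<exists>S \<subseteq> symbolic_rees J. (\<forall>p\<in>S. degree p \<le> d) \<and> algebra_gen S = symbolic_rees J)"

text \<open>Polynomials with coefficients in \<open>'k\<close> in the variables \<open>x\<^sub>v\<close>, \<open>v :: 'v\<close>: finitely supported
  functions from exponent vectors to coefficients.\<close>

type_synonym ('v, 'k) mpoly = "('v \<Rightarrow>\<^sub>0 nat) \<Rightarrow>\<^sub>0 'k"

definition var :: "'v \<Rightarrow> ('v, 'k::comm_ring_1) mpoly"
  where "var v = Poly_Mapping.single (Poly_Mapping.single v 1) 1"

definition cover_ideal :: "'v set set \<Rightarrow> ('v, 'k::comm_ring_1) mpoly set"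
  where "cover_ideal \<Delta> = (\<Inter>F\<in>bases \<Delta>. ideal_gen (var ` F))"

end

theory Submission
  imports Defs
begin

text \<open>
  The ideal \<open>J\<close> is the intersection of the primes \<open>(x\<^sub>v : v \<in> F)\<close>, so \<open>x\<^sup>m t\<^sup>l\<close> lies in the symbolic
  Rees algebra iff \<open>m\<close> is an \<open>l\<close>-cover: \<open>m\<close> has weight at least \<open>l\<close> on every basis \<open>F\<close>.

  Let \<open>A\<close> be the ground set of a component of rank \<open>r\<close>. By a greedy argument,
  peeling the squarefree monomial with support \<open>A \<inter> supp m\<close> off \<open>m\<close> splits an \<open>l\<close>-cover into an
  \<open>a\<close>-cover and an \<open>(l - a)\<close>-cover with \<open>a \<le> r\<close>; iterating this bounds the degree of the generators
  by the largest rank.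

  Conversely, if \<open>A = U\<^sub>1 \<union> U\<^sub>2\<close> split the \<open>r\<close>-cover \<open>x\<^sup>A t\<^sup>r\<close> into an \<open>l\<^sub>1\<close>-cover and an \<open>l\<^sub>2\<close>-cover with
  \<open>l\<^sub>1 + l\<^sub>2 = r\<close>, every basis of the component would meet \<open>U\<^sub>i\<close> in exactly \<open>l\<^sub>i\<close> elements, and
  the component would be a direct sum. Hence \<open>x\<^sup>A t\<^sup>r\<close> is needed as a generator.
\<close>

subsection \<open>Bases of a matroid\<close>

context matroid
begin

lemma face_ground: "S \<in> \<Delta> \<Longrightarrow> S \<subseteq> E"
  using faces_subset by auto

lemma finite_face: "S \<in> \<Delta> \<Longrightarrow> finite S"
  using face_ground finite_ground finite_subset by blast

lemma basis_face: "B \<in> bases \<Delta> \<Longrightarrow> B \<in> \<Delta>"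
  by (simp add: bases_def)

text \<open>Iterated augmentation. Keeping \<open>S'\<close> inside \<open>S \<union> T\<close> is
  what makes the later exchanges controllable: all new elements come from \<open>T\<close>.\<close>

lemma augment_to_card:
  assumes "S \<in> \<Delta>" "T \<in> \<Delta>" "card S \<le> card T"
  obtains S' where "S' \<in> \<Delta>" "S \<subseteq> S'" "S' \<subseteq> S \<union> T" "card S' = card T"
proof -
  have "\<exists>S'\<in>\<Delta>. S \<subseteq> S' \<and> S' \<subseteq> S \<union> T \<and> card S' = card T"
    using assms(1,3)
  proof (induction "card T - card S" arbitrary: S)
    case 0
    then show ?case by auto
  next
    case (Suc k)
    then obtain x where x: "x \<in> T - S" "insert x S \<in> \<Delta>"
      using augmentation[of S T] assms(2) by fastforce
    have "card (insert x S) = Suc (card S)"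
      using x Suc.prems finite_face by simp
    then have "k = card T - card (insert x S)" "card (insert x S) \<le> card T"
      using Suc.hyps(2) by linarith+
    from Suc.hyps(1)[OF this(1) x(2) this(2)] obtain S' where "S' \<in> \<Delta>" "insert x S \<subseteq> S'" "S' \<subseteq> insert x S \<union> T" "card S' = card T"
      by blast
    with x show ?case by (intro bexI[of _ S']) auto
  qed
  then show thesis using that by blast
qed

lemma card_face_le_basis:
  assumes "S \<in> \<Delta>" "B \<in> bases \<Delta>"
  shows "card S \<le> card B"
proof (rule ccontr)
  assume "\<not> card S \<le> card B"
  then obtain x where "x \<in> S - B" "insert x B \<in> \<Delta>"
    using augmentation[of B S] assms basis_face by auto
  then show False using assms(2) unfolding bases_def by blast
qed

lemma card_bases_eq: "B \<in> bases \<Delta> \<Longrightarrow> C \<in> bases \<Delta> \<Longrightarrow> card B = card C"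
  by (meson basis_face card_face_le_basis le_antisym)

lemma basisI:
  assumes "S \<in> \<Delta>" "\<And>T. T \<in> \<Delta> \<Longrightarrow> S \<subseteq> T \<Longrightarrow> card T \<le> card S"
  shows "S \<in> bases \<Delta>"
  using assms finite_face unfolding bases_def by (simp add: card_seteq)

lemma basis_of_card: "S \<in> \<Delta> \<Longrightarrow> B \<in> bases \<Delta> \<Longrightarrow> card S = card B \<Longrightarrow> S \<in> bases \<Delta>"
  by (simp add: basisI card_face_le_basis)

lemma bases_nonempty: "bases \<Delta> \<noteq> {}"
proof -
  have "\<exists>S. S \<in> \<Delta> \<and> (\<forall>T. T \<in> \<Delta> \<longrightarrow> card T \<le> card S)"
    using empty_face face_ground finite_ground
    by (intro ex_has_greatest_nat[of "\<lambda>S. S \<in> \<Delta>" "{}" card "Suc (card E)"])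
      (auto simp: less_Suc_eq_le card_mono)
  then show ?thesis using basisI by blast
qed

lemma basis_extending:
  assumes "S \<in> \<Delta>"
  obtains B where "B \<in> bases \<Delta>" "S \<subseteq> B"
proof -
  obtain F where F: "F \<in> bases \<Delta>" using bases_nonempty by auto
  obtain B where "B \<in> \<Delta>" "S \<subseteq> B" "card B = card F"
    by (rule augment_to_card[OF assms basis_face[OF F] card_face_le_basis[OF assms F]])
  then show thesis using that basis_of_card[OF _ F] by blast
qed

lemma matroid_rank_eq_card: "B \<in> bases \<Delta> \<Longrightarrow> matroid_rank \<Delta> = card B"
proof -
  assume B: "B \<in> bases \<Delta>"
  then have "card ` bases \<Delta> = {card B}"
    using card_bases_eq by blast
  then show ?thesis unfolding matroid_rank_def by simp
qed

section \<open>Restrictions and direct sum decompositions\<close>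

lemma matroid_restriction: "matroid (E \<inter> U) {S \<in> \<Delta>. S \<subseteq> U}"
proof
  show "finite (E \<inter> U)" using finite_ground by simp
  show "{S \<in> \<Delta>. S \<subseteq> U} \<subseteq> Pow (E \<inter> U)" using face_ground by auto
  show "{} \<in> {S \<in> \<Delta>. S \<subseteq> U}" using empty_face by simp
  show "T \<in> {S \<in> \<Delta>. S \<subseteq> U}" if "S \<in> {S \<in> \<Delta>. S \<subseteq> U}" "T \<subseteq> S" for S T
    using that face_mono by auto
  show "\<exists>x\<in>T - S. insert x S \<in> {S \<in> \<Delta>. S \<subseteq> U}"
    if "S \<in> {S \<in> \<Delta>. S \<subseteq> U}" "T \<in> {S \<in> \<Delta>. S \<subseteq> U}" "card S < card T" for S T
    using that augmentation[of S T] by blast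
qed

text \<open>A face inside \<open>U\<close> extends to a basis of \<Delta>, so it has at most
  \<open>l\<close> elements. This bound is attained by \<open>F \<inter> U\<close> for any basis
  \<open>F\<close>, so the bases of the restriction are its faces of size \<open>l\<close>.\<close>

lemma basis_restriction_iff:
  assumes "\<And>F. F \<in> bases \<Delta> \<Longrightarrow> card (F \<inter> U) = l"
  shows "S \<in> bases {S \<in> \<Delta>. S \<subseteq> U} \<longleftrightarrow> S \<in> \<Delta> \<and> S \<subseteq> U \<and> card S = l"
proof -
  interpret R: matroid "E \<inter> U" "{S \<in> \<Delta>. S \<subseteq> U}" by (rule matroid_restriction)
  obtain F where F: "F \<in> bases \<Delta>" using bases_nonempty by auto
  have le: "card T \<le> l" if T: "T \<in> \<Delta>" "T \<subseteq> U" for T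
  proof -
    obtain B where B: "B \<in> bases \<Delta>" "T \<subseteq> B" using basis_extending T by metis
    then have "T \<subseteq> B \<inter> U" "finite (B \<inter> U)" using T basis_face finite_face by auto
    then show ?thesis using assms[OF B(1)] card_mono by metis
  qed
  have "F \<inter> U \<in> {S \<in> \<Delta>. S \<subseteq> U}" using F basis_face face_mono by blast
  then have "F \<inter> U \<in> bases {S \<in> \<Delta>. S \<subseteq> U}"
    using le assms[OF F] by (intro R.basisI) auto
  from R.card_bases_eq[OF _ this] R.basis_of_card[OF _ this] R.basis_face show ?thesis
    unfolding assms[OF F] by blast
qed

text \<open>Constant intersection sizes leave no room for interaction between the two sides: a basis
  built from \<open>F\<^sub>1\<close> and \<open>F\<^sub>2\<close> cannot pick up any further
  element in \<open>U\<^sub>1\<close> or in \<open>U\<^sub>2\<close>.\<close>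

lemma direct_sum_of_constant_card:
  assumes part: "U\<^sub>1 \<inter> U\<^sub>2 = {}" "U\<^sub>1 \<union> U\<^sub>2 = E"
    and card1: "\<And>F. F \<in> bases \<Delta> \<Longrightarrow> card (F \<inter> U\<^sub>1) = l\<^sub>1"
    and card2: "\<And>F. F \<in> bases \<Delta> \<Longrightarrow> card (F \<inter> U\<^sub>2) = l\<^sub>2"
  shows "is_direct_sum E \<Delta> U\<^sub>1 {S \<in> \<Delta>. S \<subseteq> U\<^sub>1} U\<^sub>2 {S \<in> \<Delta>. S \<subseteq> U\<^sub>2}"
proof -
  let ?D = "\<lambda>U. {S \<in> \<Delta>. S \<subseteq> U}"
  note iff1 = basis_restriction_iff[of U\<^sub>1, OF card1]
  note iff2 = basis_restriction_iff[of U\<^sub>2, OF card2]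
  have "F \<in> {F\<^sub>1 \<union> F\<^sub>2 | F\<^sub>1 F\<^sub>2. F\<^sub>1 \<in> bases (?D U\<^sub>1) \<and> F\<^sub>2 \<in> bases (?D U\<^sub>2)}"
    if F: "F \<in> bases \<Delta>" for F
  proof -
    have "F \<inter> U\<^sub>1 \<in> \<Delta>" "F \<inter> U\<^sub>2 \<in> \<Delta>"
      using F basis_face face_mono by blast+
    then have "F \<inter> U\<^sub>1 \<in> bases (?D U\<^sub>1)" "F \<inter> U\<^sub>2 \<in> bases (?D U\<^sub>2)"
      using card1 card2 F by (simp_all add: iff1 iff2)
    moreover have "F = (F \<inter> U\<^sub>1) \<union> (F \<inter> U\<^sub>2)"
      using F basis_face face_ground part by blast
    ultimately show ?thesis by blast
  qed
  moreover have "F\<^sub>1 \<union> F\<^sub>2 \<in> bases \<Delta>"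
    if F1: "F\<^sub>1 \<in> bases (?D U\<^sub>1)" and F2: "F\<^sub>2 \<in> bases (?D U\<^sub>2)" for F\<^sub>1 F\<^sub>2
  proof -
    have F1': "F\<^sub>1 \<in> \<Delta>" "F\<^sub>1 \<subseteq> U\<^sub>1" "card F\<^sub>1 = l\<^sub>1" and F2': "F\<^sub>2 \<in> \<Delta>" "F\<^sub>2 \<subseteq> U\<^sub>2" "card F\<^sub>2 = l\<^sub>2"
      using F1 F2 iff1 iff2 by auto
    obtain B where B: "B \<in> bases \<Delta>" "F\<^sub>1 \<subseteq> B" using basis_extending F1' by metis
    have BF: "B \<inter> U\<^sub>1 = F\<^sub>1"
      using card1[OF B(1)] F1' B basis_face finite_face
      by (metis card_subset_eq finite_Int le_inf_iff)
    \<comment> \<open>Extending \<open>F\<^sub>2\<close> by elements of \<open>B\<close> only gives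
      \<open>C \<inter> U\<^sub>1 \<subseteq> B \<inter> U\<^sub>1 = F\<^sub>1\<close>; counting
      turns this into equality.\<close>
    obtain C where C: "C \<in> \<Delta>" "F\<^sub>2 \<subseteq> C" "C \<subseteq> F\<^sub>2 \<union> B" "card C = card B"
      using augment_to_card[of F\<^sub>2 B] F2' B basis_face card_face_le_basis by metis
    have Cb: "C \<in> bases \<Delta>" using C B basis_of_card by blast
    have fin: "finite C" "finite F\<^sub>1" using C F1' finite_face by auto
    have "C \<inter> U\<^sub>2 = F\<^sub>2"
      using card2[OF Cb] F2' C fin by (metis card_subset_eq finite_Int le_inf_iff)
    moreover have "C \<inter> U\<^sub>1 \<subseteq> F\<^sub>1" using C BF F2' part by blast
    then have "C \<inter> U\<^sub>1 = F\<^sub>1" using card1[OF Cb] F1' fin by (metis card_subset_eq)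
    ultimately have "C = F\<^sub>1 \<union> F\<^sub>2" using face_ground[OF C(1)] part by blast
    then show ?thesis using Cb by simp
  qed
  ultimately have "bases \<Delta> = {F\<^sub>1 \<union> F\<^sub>2 | F\<^sub>1 F\<^sub>2. F\<^sub>1 \<in> bases (?D U\<^sub>1) \<and> F\<^sub>2 \<in> bases (?D U\<^sub>2)}"
    by blast
  moreover have "E \<inter> U\<^sub>1 = U\<^sub>1" "E \<inter> U\<^sub>2 = U\<^sub>2" using part by auto
  ultimately show ?thesis
    using part matroid_restriction[of U\<^sub>1] matroid_restriction[of U\<^sub>2] matroid_axioms
    unfolding is_direct_sum_def by auto
qed

text \<open>The two lower bounds already add up to the rank, so both are equalities on every basis,
  and \<open>direct_sum_of_constant_card\<close> splits the matroid. Connectedness then forces one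
  side to be empty.\<close>

lemma connected_cover_trivial:
  assumes conn: "connected_matroid E \<Delta>"
    and part: "U\<^sub>1 \<inter> U\<^sub>2 = {}" "U\<^sub>1 \<union> U\<^sub>2 = E"
    and cover1: "\<And>F. F \<in> bases \<Delta> \<Longrightarrow> l\<^sub>1 \<le> card (F \<inter> U\<^sub>1)"
    and cover2: "\<And>F. F \<in> bases \<Delta> \<Longrightarrow> l\<^sub>2 \<le> card (F \<inter> U\<^sub>2)"
    and rank: "l\<^sub>1 + l\<^sub>2 = matroid_rank \<Delta>"
  shows "U\<^sub>1 = {} \<or> U\<^sub>2 = {}"
proof -
  have "card (F \<inter> U\<^sub>1) = l\<^sub>1 \<and> card (F \<inter> U\<^sub>2) = l\<^sub>2" if F: "F \<in> bases \<Delta>" for F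
  proof -
    have "finite F" "F = (F \<inter> U\<^sub>1) \<union> (F \<inter> U\<^sub>2)"
      using F basis_face finite_face face_ground part by blast+
    then have "card F = card (F \<inter> U\<^sub>1) + card (F \<inter> U\<^sub>2)"
      using part card_Un_disjoint[of "F \<inter> U\<^sub>1" "F \<inter> U\<^sub>2"] by fastforce
    then show ?thesis
      using cover1[OF F] cover2[OF F] rank matroid_rank_eq_card[OF F] by linarith
  qed
  then have "is_direct_sum E \<Delta> U\<^sub>1 {S \<in> \<Delta>. S \<subseteq> U\<^sub>1} U\<^sub>2 {S \<in> \<Delta>. S \<subseteq> U\<^sub>2}"
    using direct_sum_of_constant_card[OF part] by blast
  then show ?thesis
    using conn unfolding connected_matroid_def disconnected_matroid_def by blast
qed

text \<open>As in the greedy algorithm, some basis minimises the weight \<open>w - 1\<^sub>U\<close> and \<open>card (F \<inter> U)\<close>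
  simultaneously: an exchange that lowers \<open>card (F \<inter> U)\<close> replaces an element of \<open>U\<close> by one of
  \<open>A - U\<close>, where \<open>w\<close> vanishes.\<close>

lemma cover_peel:
  fixes A :: "'v set" and w :: "'v \<Rightarrow> nat" and l r :: nat
  defines "U \<equiv> {v \<in> A. 0 < w v}"
  assumes rank: "\<And>F. F \<in> bases \<Delta> \<Longrightarrow> card (F \<inter> A) = r"
    and cover: "\<And>F. F \<in> bases \<Delta> \<Longrightarrow> l \<le> sum w F"
  obtains a where "a \<le> r" "\<And>F. F \<in> bases \<Delta> \<Longrightarrow> a \<le> card (F \<inter> U)"
    "\<And>F. F \<in> bases \<Delta> \<Longrightarrow> l - a \<le> (\<Sum>v\<in>F. w v - of_bool (v \<in> U))"
proof -
  define w' where "w' v = w v - of_bool (v \<in> U)" for v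
  have w_split: "w v = w' v + of_bool (v \<in> U)" for v
    by (auto simp: w'_def U_def)
  obtain F\<^sub>0 where F0: "F\<^sub>0 \<in> bases \<Delta>" "\<And>G. G \<in> bases \<Delta> \<Longrightarrow> sum w' F\<^sub>0 \<le> sum w' G"
    using ex_has_least_nat[of "\<lambda>F. F \<in> bases \<Delta>" _ "sum w'"] bases_nonempty by blast
  \<comment> \<open>Lexicographic minimum: first the weight \<open>w'\<close>, then
    \<open>card (F \<inter> U)\<close> among the bases of least weight. The claim \<open>min\<close>
    extends the second minimality to all bases.\<close>
  obtain F where F: "F \<in> bases \<Delta>" "sum w' F \<le> sum w' F\<^sub>0"
    and Fmin: "\<And>G. G \<in> bases \<Delta> \<Longrightarrow> sum w' G \<le> sum w' F\<^sub>0 \<Longrightarrow> card (F \<inter> U) \<le> card (G \<inter> U)"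
    using ex_has_least_nat[of "\<lambda>F. F \<in> bases \<Delta> \<and> sum w' F \<le> sum w' F\<^sub>0" F\<^sub>0 "\<lambda>F. card (F \<inter> U)"] F0
    by blast
  have finF: "finite F" using F basis_face finite_face by blast
  have min: "card (F \<inter> U) \<le> card (G \<inter> U)" if G: "G \<in> bases \<Delta>" for G
  proof (rule ccontr)
    assume less: "\<not> card (F \<inter> U) \<le> card (G \<inter> U)"
    have finG: "finite G" using G basis_face finite_face by blast
    \<comment> \<open>Bases have equal size, so \<open>G\<close> meeting \<open>U\<close> in fewer
      elements has more elements outside \<open>U\<close>. This allows augmenting
      \<open>F - U\<close> from \<open>G - U\<close>.\<close>
    have "card (F - U) + card (F \<inter> U) = card (G - U) + card (G \<inter> U)"
      using card_bases_eq[OF F(1) G] finF finG card_Int_Diff[of F U] card_Int_Diff[of G U]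
      by simp
    then have "card (F - U) < card (G - U)" using less by linarith
    moreover have "F - U \<in> \<Delta>" "G - U \<in> \<Delta>"
      using F G basis_face face_mono by (meson Diff_subset)+
    ultimately obtain x where x: "x \<in> G - U" "x \<notin> F" "insert x (F - U) \<in> \<Delta>"
      using augmentation[of "F - U" "G - U"] by blast
    \<comment> \<open>Refilling with elements of \<open>F\<close> gives a basis that differs from
      \<open>F\<close> by the exchange of a single \<open>y\<close> for \<open>x\<close>; since
      \<open>F - U\<close> is kept, \<open>y\<close> lies in \<open>U\<close>.\<close>
    obtain B where B: "B \<in> \<Delta>" "insert x (F - U) \<subseteq> B" "B \<subseteq> insert x (F - U) \<union> F" "card B = card F"
      using augment_to_card[of "insert x (F - U)" F] x F basis_face card_face_le_basis by metis
    have Bb: "B \<in> bases \<Delta>" using B F basis_of_card by blast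
    have "card (F - B) = card (B - F)"
      using B finF finite_face card_Int_Diff[of F B] card_Int_Diff[of B F] by (simp add: Int_commute)
    also have "B - F = {x}" using B x by blast
    finally obtain y where y: "F - B = {y}" by (auto simp: card_Suc_eq)
    have yU: "y \<in> U" "y \<in> F" using y B by blast+
    have Beq: "B = insert x (F - {y})" using y B x by blast
    \<comment> \<open>Every basis meets \<open>A\<close> in \<open>r\<close> elements, so the loss
      of \<open>y\<close>, which lies in \<open>A\<close>, has to be made up by \<open>x\<close>.
      Hence \<open>x\<close> is in \<open>A - U\<close>, where the weight is 0.\<close>
    have xA: "x \<in> A"
    proof (rule ccontr)
      assume "x \<notin> A"
      then have "B \<inter> A = F \<inter> A - {y}" using Beq by blast
      moreover have "y \<in> F \<inter> A" using yU U_def by simp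
      ultimately have "card (B \<inter> A) < card (F \<inter> A)"
        using finF by (metis card_Diff1_less finite_Int)
      then show False using rank[OF Bb] rank[OF F(1)] by simp
    qed
    then have "w' x = 0" using x by (auto simp: w'_def U_def)
    then have "sum w' B \<le> sum w' F"
      using Beq finF x yU by (simp add: sum.remove[of F y])
    then have "card (F \<inter> U) \<le> card (B \<inter> U)" using Fmin[OF Bb] F(2) by linarith
    moreover have "B \<inter> U = F \<inter> U - {y}" using Beq x by blast
    moreover have "y \<in> F \<inter> U" using yU by simp
    ultimately show False using finF by (metis card_Diff1_less finite_Int not_le)
  qed
  have sum_split: "sum w F = sum w' F + card (F \<inter> U)"
    using finF by (simp add: w_split sum.distrib of_bool_def sum.If_cases Int_def)
  have "card (F \<inter> U) \<le> card (F \<inter> A)"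
    using finF by (intro card_mono) (auto simp: U_def)
  then have "card (F \<inter> U) \<le> r" using rank F by simp
  \<comment> \<open>With \<open>a = card (F \<inter> U)\<close>, the cover condition on
    \<open>F\<close> alone reads \<open>l \<le> sum w' F + a\<close>. As \<open>F\<close> has least
    \<open>w'\<close>-weight, the bound passes to every basis \<open>G\<close>.\<close>
  moreover have "l - card (F \<inter> U) \<le> sum w' G" if "G \<in> bases \<Delta>" for G
    using cover[OF F(1)] sum_split F F0(2)[OF that] by linarith
  ultimately show thesis
    using that[of "card (F \<inter> U)"] min unfolding w'_def by blast
qed

end


subsection \<open>Monomial primes and their powers\<close>

definition weight :: "('v \<Rightarrow>\<^sub>0 nat) \<Rightarrow> 'v set \<Rightarrow> nat"
  where "weight m F = (\<Sum>v\<in>F. Poly_Mapping.lookup m v)"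

definition set_monomial :: "'v set \<Rightarrow> ('v \<Rightarrow>\<^sub>0 nat)"
  where "set_monomial U = (\<Sum>v\<in>U. Poly_Mapping.single v 1)"

text \<open>For finite \<open>F\<close> this is the \<open>l\<close>-th power of the prime generated
  by the variables in \<open>F\<close>, see \<open>ideal_power_weight_ideal\<close>. Stated on
  exponents, membership can be checked one monomial at a time.\<close>

definition weight_ideal :: "'v set \<Rightarrow> nat \<Rightarrow> ('v, 'k::comm_ring_1) mpoly set"
  where "weight_ideal F l = {p. \<forall>m\<in>Poly_Mapping.keys p. l \<le> weight m F}"

lemma weight_zero [simp]: "weight 0 F = 0"
  by (simp add: weight_def)

lemma weight_add: "weight (m + n) F = weight m F + weight n F"
  by (simp add: weight_def lookup_add sum.distrib)

lemma lookup_set_monomial: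
  "finite U \<Longrightarrow> Poly_Mapping.lookup (set_monomial U) v = of_bool (v \<in> U)"
  by (simp add: set_monomial_def lookup_sum lookup_single when_def)

lemma weight_set_monomial:
  "finite U \<Longrightarrow> finite F \<Longrightarrow> weight (set_monomial U) F = card (F \<inter> U)"
  by (simp add: weight_def lookup_set_monomial of_bool_def sum.If_cases Int_def)

lemma weight_single: "finite F \<Longrightarrow> weight (Poly_Mapping.single v n) F = (if v \<in> F then n else 0)"
  by (simp add: weight_def lookup_single when_def)

lemma mpoly_eq_sum_monomials:
  fixes p :: "'a \<Rightarrow>\<^sub>0 'b::comm_monoid_add"
  shows "(\<Sum>m\<in>Poly_Mapping.keys p. Poly_Mapping.single m (Poly_Mapping.lookup p m)) = p"
  by (rule poly_mapping_eqI) (auto simp: lookup_sum lookup_single when_def in_keys_iff)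

lemma lookup_times:
  fixes p q :: "('a::comm_monoid_add) \<Rightarrow>\<^sub>0 ('b::comm_ring_1)"
  shows "Poly_Mapping.lookup (p * q) k = (\<Sum>m\<in>Poly_Mapping.keys p. \<Sum>n\<in>Poly_Mapping.keys q.
    if m + n = k then Poly_Mapping.lookup p m * Poly_Mapping.lookup q n else 0)"
proof -
  have "p * q = (\<Sum>m\<in>Poly_Mapping.keys p. \<Sum>n\<in>Poly_Mapping.keys q.
      Poly_Mapping.single (m + n) (Poly_Mapping.lookup p m * Poly_Mapping.lookup q n))"
    by (subst (1) mpoly_eq_sum_monomials[of p, symmetric],
        subst (1) mpoly_eq_sum_monomials[of q, symmetric])
      (simp add: sum_product mult_single)
  then show ?thesis
    by (simp add: lookup_sum lookup_single when_def)
qed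

lemma keys_times_monomial:
  fixes p :: "('v, 'k::comm_ring_1) mpoly"
  shows "Poly_Mapping.keys (p * Poly_Mapping.single n 1) = (\<lambda>m. m + n) ` Poly_Mapping.keys p"
proof -
  let ?q = "p * Poly_Mapping.single n 1"
  have lookup: "Poly_Mapping.lookup ?q k
      = (\<Sum>m\<in>Poly_Mapping.keys p. if m + n = k then Poly_Mapping.lookup p m else 0)" for k
    by (simp add: lookup_times cong: if_cong)
  show ?thesis
  proof (intro equalityI subsetI)
    show "k \<in> (\<lambda>m. m + n) ` Poly_Mapping.keys p" if "k \<in> Poly_Mapping.keys ?q" for k
      using that keys_mult[of p "Poly_Mapping.single n 1"] by auto
    show "k \<in> Poly_Mapping.keys ?q" if k: "k \<in> (\<lambda>m. m + n) ` Poly_Mapping.keys p" for k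
    proof -
      obtain m where m: "m \<in> Poly_Mapping.keys p" "k = m + n" using k by auto
      then have "Poly_Mapping.lookup ?q k = Poly_Mapping.lookup p m"
        by (simp add: lookup)
      then show ?thesis using m(1) by (simp add: in_keys_iff)
    qed
  qed
qed

lemma is_ideal_weight_ideal: "is_ideal (weight_ideal F l :: ('v, 'k::comm_ring_1) mpoly set)"
proof (rule module.subspaceI[OF module_times])
  show "0 \<in> (weight_ideal F l :: ('v, 'k) mpoly set)"
    by (simp add: weight_ideal_def)
  show "p + q \<in> weight_ideal F l"
    if "p \<in> weight_ideal F l" "q \<in> weight_ideal F l" for p q :: "('v, 'k) mpoly"
    using that keys_add[of p q] by (auto simp: weight_ideal_def)
  show "p * q \<in> weight_ideal F l"
    if "q \<in> weight_ideal F l" for p q :: "('v, 'k) mpoly"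
    using that keys_mult[of p q] by (fastforce simp: weight_ideal_def weight_add)
qed

lemma weight_ideal_times:
  fixes p q :: "('v, 'k::comm_ring_1) mpoly"
  assumes "p \<in> weight_ideal F a" "q \<in> weight_ideal F b"
  shows "p * q \<in> weight_ideal F (a + b)"
  using assms keys_mult[of p q] by (fastforce simp: weight_ideal_def weight_add intro: add_mono)

lemma mem_ideal_if_monomials:
  fixes p :: "('v, 'k::comm_ring_1) mpoly"
  assumes "is_ideal I"
    and "\<And>m. m \<in> Poly_Mapping.keys p \<Longrightarrow> Poly_Mapping.single m (Poly_Mapping.lookup p m) \<in> I"
  shows "p \<in> I"
  using module.subspace_sum[OF module_times assms(1),
      of "Poly_Mapping.keys p" "\<lambda>m. Poly_Mapping.single m (Poly_Mapping.lookup p m)"] assms(2)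
  by (simp add: mpoly_eq_sum_monomials)

lemma weight_Suc_split:
  assumes "Suc l \<le> weight m F"
  obtains v m' where "v \<in> F" "m = Poly_Mapping.single v 1 + m'" "l \<le> weight m' F"
proof -
  \<comment> \<open>A sum over an infinite set is 0 by convention, which would contradict the
    positive weight.\<close>
  have fin: "finite F"
    using assms by (metis Suc_n_not_le_n le_trans sum.infinite weight_def zero_le)
  obtain v where v: "v \<in> F" "Poly_Mapping.lookup m v \<noteq> 0"
    using assms unfolding weight_def by (metis not_less_eq_eq sum.neutral zero_le)
  \<comment> \<open>Subtraction of exponents truncates at 0; adding back recovers \<open>m\<close>
    because \<open>v\<close> has a positive exponent.\<close>
  have m: "m = Poly_Mapping.single v 1 + (m - Poly_Mapping.single v 1)"
    using v by (intro poly_mapping_eqI) (auto simp: lookup_add lookup_minus lookup_single when_def)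
  have "weight m F = 1 + weight (m - Poly_Mapping.single v 1) F"
    using arg_cong[OF m, of "\<lambda>m. weight m F"] v fin by (simp add: weight_add weight_single)
  then show thesis
    using that[OF v(1) m] assms by simp
qed

lemma ideal_gen_vars:
  assumes "finite F"
  shows "ideal_gen (var ` F) = (weight_ideal F 1 :: ('v, 'k::comm_ring_1) mpoly set)"
proof
  show "ideal_gen (var ` F) \<subseteq> (weight_ideal F 1 :: ('v, 'k) mpoly set)"
    using assms
    by (intro module.span_minimal[OF module_times] is_ideal_weight_ideal)
      (auto simp: weight_ideal_def var_def weight_single)
  show "(weight_ideal F 1 :: ('v, 'k) mpoly set) \<subseteq> ideal_gen (var ` F)"
  proof
    fix p :: "('v, 'k) mpoly"
    assume p: "p \<in> weight_ideal F 1"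
    show "p \<in> ideal_gen (var ` F)"
    proof (rule mem_ideal_if_monomials[OF module.subspace_span[OF module_times]])
      fix m
      assume "m \<in> Poly_Mapping.keys p"
      then have "Suc 0 \<le> weight m F" using p by (auto simp: weight_ideal_def)
      then obtain v m' where v: "v \<in> F" "m = Poly_Mapping.single v 1 + m'"
        by (rule weight_Suc_split)
      let ?c = "Poly_Mapping.lookup p m"
      have "Poly_Mapping.single m ?c = Poly_Mapping.single m' ?c * var v"
        by (simp add: v(2) var_def mult_single add.commute)
      then show "Poly_Mapping.single m ?c \<in> ideal_gen (var ` F)"
        using v(1) by (simp add: module.span_scale[OF module_times] module.span_base[OF module_times])
    qed
  qed
qed

text \<open>Weights add under multiplication, which gives one inclusion. Conversely, a monomial of
  weight at least \<open>l + 1\<close> is a variable from \<open>F\<close> times a monomial of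
  weight at least \<open>l\<close>.\<close>

lemma ideal_power_weight_ideal:
  assumes "finite F"
  shows "ideal_power (weight_ideal F 1) l = (weight_ideal F l :: ('v, 'k::comm_ring_1) mpoly set)"
proof (induction l)
  case 0
  then show ?case by (simp add: weight_ideal_def)
next
  case (Suc l)
  let ?G = "{a * b | a b. a \<in> weight_ideal F 1 \<and> b \<in> (weight_ideal F l :: ('v, 'k) mpoly set)}"
  have "ideal_gen ?G \<subseteq> weight_ideal F (Suc l)"
    using weight_ideal_times[of _ F 1 _ l]
    by (intro module.span_minimal[OF module_times] is_ideal_weight_ideal) auto
  moreover have "p \<in> ideal_gen ?G" if p: "p \<in> weight_ideal F (Suc l)" for p
  proof (rule mem_ideal_if_monomials[OF module.subspace_span[OF module_times]])
    fix m
    assume "m \<in> Poly_Mapping.keys p"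
    then have "Suc l \<le> weight m F" using p by (auto simp: weight_ideal_def)
    then obtain v m' where v: "v \<in> F" "m = Poly_Mapping.single v 1 + m'" "l \<le> weight m' F"
      by (rule weight_Suc_split)
    let ?c = "Poly_Mapping.lookup p m"
    have "Poly_Mapping.single m ?c = var v * Poly_Mapping.single m' ?c"
      by (simp add: v(2) var_def mult_single)
    moreover have "var v \<in> (weight_ideal F 1 :: ('v, 'k) mpoly set)"
      using v(1) assms by (simp add: weight_ideal_def var_def weight_single)
    moreover have "Poly_Mapping.single m' ?c \<in> weight_ideal F l"
      using v(3) by (simp add: weight_ideal_def)
    ultimately show "Poly_Mapping.single m ?c \<in> ideal_gen ?G"
      by (intro module.span_base[OF module_times]) blast
  qed
  ultimately have "ideal_gen ?G = weight_ideal F (Suc l)" by blast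
  then show ?case unfolding ideal_power.simps Suc.IH .
qed

text \<open>Without a monomial order at hand, a pair of leading monomials is found by maximising the
  exponents one variable at a time.\<close>

lemma unique_monomial_sum:
  fixes A B :: "('v \<Rightarrow>\<^sub>0 nat) set"
  assumes "finite V" "finite A" "finite B" "A \<noteq> {}" "B \<noteq> {}"
  shows "\<exists>a\<in>A. \<exists>b\<in>B. \<forall>a'\<in>A. \<forall>b'\<in>B. a' + b' = a + b \<longrightarrow>
    (\<forall>v\<in>V. Poly_Mapping.lookup a' v = Poly_Mapping.lookup a v)"
  using assms
proof (induction V arbitrary: A B rule: finite_induct)
  case empty
  then show ?case by auto
next
  case (insert v V)
  let ?top = "\<lambda>A. {a \<in> A. \<forall>a'\<in>A. Poly_Mapping.lookup a' v \<le> Poly_Mapping.lookup a v}"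
  have top: "?top C \<noteq> {}" if "finite C" "C \<noteq> {}" for C :: "('v \<Rightarrow>\<^sub>0 nat) set"
  proof -
    have "Max ((\<lambda>m. Poly_Mapping.lookup m v) ` C) \<in> (\<lambda>m. Poly_Mapping.lookup m v) ` C"
      using that by (intro Max_in) auto
    then obtain c where "c \<in> C"
      "Max ((\<lambda>m. Poly_Mapping.lookup m v) ` C) = Poly_Mapping.lookup c v" by auto
    moreover have "Poly_Mapping.lookup c' v \<le> Max ((\<lambda>m. Poly_Mapping.lookup m v) ` C)"
      if "c' \<in> C" for c'
      using that \<open>finite C\<close> by (intro Max_ge) auto
    ultimately show ?thesis by auto
  qed
  have "finite (?top A)" "finite (?top B)" using insert.prems by auto
  from insert.IH[OF this top top] insert.prems
  obtain a b where ab: "a \<in> ?top A" "b \<in> ?top B" and unique: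
    "\<forall>a'\<in>?top A. \<forall>b'\<in>?top B. a' + b' = a + b \<longrightarrow>
      (\<forall>v\<in>V. Poly_Mapping.lookup a' v = Poly_Mapping.lookup a v)"
    by blast
  have "\<forall>u\<in>insert v V. Poly_Mapping.lookup a' u = Poly_Mapping.lookup a u"
    if a': "a' \<in> A" and b': "b' \<in> B" and eq: "a' + b' = a + b" for a' b'
  proof -
    \<comment> \<open>Both \<open>a\<close> and \<open>b\<close> have the largest exponent of
      \<open>v\<close>, so a pair with the same sum must attain both maxima. It thus lies in the two
      \<open>?top\<close> sets, where the induction hypothesis applies.\<close>
    have "Poly_Mapping.lookup a' v + Poly_Mapping.lookup b' v
        = Poly_Mapping.lookup a v + Poly_Mapping.lookup b v"
      using eq by (metis lookup_add)
    moreover have "Poly_Mapping.lookup a' v \<le> Poly_Mapping.lookup a v"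
      "Poly_Mapping.lookup b' v \<le> Poly_Mapping.lookup b v"
      using ab a' b' by auto
    ultimately have "Poly_Mapping.lookup a' v = Poly_Mapping.lookup a v"
      "Poly_Mapping.lookup b' v = Poly_Mapping.lookup b v"
      by linarith+
    moreover from this have "a' \<in> ?top A" "b' \<in> ?top B"
      using ab a' b' by auto
    ultimately show ?thesis using unique eq by blast
  qed
  then show ?case using ab by blast
qed

text \<open>A polynomial outside the ideal has terms of weight 0 on \<open>F\<close>. Among these
  terms of \<open>p\<close> and \<open>q\<close>, a pair with uniquely represented sum contributes a
  coefficient to \<open>p * q\<close> that nothing cancels and that is nonzero in a domain.\<close>

lemma prime_weight_ideal: "prime_ideal (weight_ideal F 1 :: ('v::finite, 'k::idom) mpoly set)"
proof -
  have "p * q \<notin> weight_ideal F 1"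
    if p: "p \<notin> weight_ideal F 1" and q: "q \<notin> weight_ideal F 1" for p q :: "('v, 'k) mpoly"
  proof -
    let ?low = "\<lambda>p :: ('v, 'k) mpoly. {m \<in> Poly_Mapping.keys p. weight m F = 0}"
    have "?low p \<noteq> {}" "?low q \<noteq> {}"
      using p q by (force simp: weight_ideal_def)+
    then obtain m n where mn: "m \<in> ?low p" "n \<in> ?low q" and unique:
      "\<forall>m'\<in>?low p. \<forall>n'\<in>?low q. m' + n' = m + n \<longrightarrow>
        (\<forall>v\<in>UNIV. Poly_Mapping.lookup m' v = Poly_Mapping.lookup m v)"
      using unique_monomial_sum[of UNIV "?low p" "?low q"] by auto
    have eq_iff: "m' + n' = m + n \<longleftrightarrow> m' = m \<and> n' = n"
      if "m' \<in> Poly_Mapping.keys p" "n' \<in> Poly_Mapping.keys q" for m' n'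
    proof
      assume eq: "m' + n' = m + n"
      \<comment> \<open>The total weight is 0, so terms of positive weight cannot contribute to
        \<open>m + n\<close>.\<close>
      then have "weight m' F + weight n' F = weight m F + weight n F"
        by (metis weight_add)
      then have "m' \<in> ?low p" "n' \<in> ?low q" using mn that by auto
      then have "m' = m" using unique eq by (intro poly_mapping_eqI) auto
      then show "m' = m \<and> n' = n" using eq by simp
    qed simp
    have "Poly_Mapping.lookup (p * q) (m + n)
        = (\<Sum>m'\<in>Poly_Mapping.keys p. \<Sum>n'\<in>Poly_Mapping.keys q. if m' = m \<and> n' = n
            then Poly_Mapping.lookup p m' * Poly_Mapping.lookup q n' else 0)"
      unfolding lookup_times by (intro sum.cong refl) (simp add: eq_iff)
    also have "\<dots> = (\<Sum>m'\<in>Poly_Mapping.keys p. if m' = m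
            then Poly_Mapping.lookup p m * Poly_Mapping.lookup q n else 0)"
      using mn by (intro sum.cong refl) (auto simp: sum.delta)
    also have "\<dots> = Poly_Mapping.lookup p m * Poly_Mapping.lookup q n"
      using mn by (simp add: sum.delta)
    finally have "m + n \<in> Poly_Mapping.keys (p * q)"
      using mn by (simp add: in_keys_iff)
    moreover have "weight (m + n) F = 0" using mn by (simp add: weight_add)
    ultimately show ?thesis by (force simp: weight_ideal_def)
  qed
  moreover have "1 \<notin> (weight_ideal F 1 :: ('v, 'k) mpoly set)"
    by (simp add: weight_ideal_def)
  ultimately show ?thesis
    unfolding prime_ideal_def using is_ideal_weight_ideal by blast
qed

text \<open>Otherwise choose in each ideal an element outside \<open>P\<close>. Their product lies
  in the intersection, hence in \<open>P\<close>, against primality. For empty \<open>X\<close> the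
  contradiction is \<open>1 \<in> P\<close>.\<close>

lemma prime_ideal_Inter_subset:
  assumes "finite X" "prime_ideal P" "\<And>F. F \<in> X \<Longrightarrow> is_ideal (I F)" "(\<Inter>F\<in>X. I F) \<subseteq> P"
  shows "\<exists>F\<in>X. I F \<subseteq> P"
proof (rule ccontr)
  assume "\<not> (\<exists>F\<in>X. I F \<subseteq> P)"
  then obtain f where f: "\<And>F. F \<in> X \<Longrightarrow> f F \<in> I F" "\<And>F. F \<in> X \<Longrightarrow> f F \<notin> P"
    unfolding subset_iff by metis
  have "1 \<notin> P"
    using assms(2) module.subspace_scale[OF module_times, of P 1]
    unfolding prime_ideal_def by auto
  moreover have "prod f X \<in> P"
  proof -
    have "prod f X \<in> I F" if F: "F \<in> X" for F
    proof -
      have "prod f X = prod f (X - {F}) * f F"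
        using F assms(1) by (simp add: prod.remove mult.commute)
      then show ?thesis
        using module.subspace_scale[OF module_times assms(3)[OF F] f(1)[OF F]] by simp
    qed
    then show ?thesis using assms(4) by blast
  qed
  moreover have "prod f Y \<notin> P" if "finite Y" "Y \<subseteq> X" for Y
    using that
    by (induction Y rule: finite_induct)
      (use \<open>1 \<notin> P\<close> f(2) assms(2) in \<open>auto simp: prime_ideal_def\<close>)
  ultimately show False using assms(1) by blast
qed

subsection \<open>The symbolic Rees algebra of a cover ideal\<close>

definition is_cover :: "'v set set \<Rightarrow> nat \<Rightarrow> ('v \<Rightarrow>\<^sub>0 nat) \<Rightarrow> bool"
  where "is_cover \<Delta> l m \<longleftrightarrow> (\<forall>F\<in>bases \<Delta>. l \<le> weight m F)"

lemma cover_ideal_eq: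
  fixes \<Delta> :: "'v::finite set set"
  shows "cover_ideal \<Delta> = (\<Inter>F\<in>bases \<Delta>. weight_ideal F 1 :: ('v, 'k::comm_ring_1) mpoly set)"
  by (simp add: cover_ideal_def ideal_gen_vars del: One_nat_def)

text \<open>The annihilator of \<open>f\<close> modulo the cover ideal is the intersection of those
  primes of bases that do not contain \<open>f\<close>. If this finite intersection is prime, it
  equals one of them.\<close>

lemma associated_primes_cover_ideal:
  fixes \<Delta> :: "'v::finite set set"
  shows "associated_primes (cover_ideal \<Delta> :: ('v, 'k::idom) mpoly set)
    = (\<lambda>F. weight_ideal F 1) ` bases \<Delta>"
proof (intro equalityI subsetI)
  fix P :: "('v, 'k) mpoly set"
  assume "P \<in> associated_primes (cover_ideal \<Delta>)"
  then obtain f where P: "prime_ideal P" "P = {r. r * f \<in> cover_ideal \<Delta>}"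
    by (auto simp: associated_primes_def)
  define X where "X = {F \<in> bases \<Delta>. f \<notin> weight_ideal F 1}"
  have "r * f \<in> weight_ideal F 1 \<longleftrightarrow> r \<in> weight_ideal F 1 \<or> f \<in> weight_ideal F 1" for r F
    using prime_weight_ideal[of F] is_ideal_weight_ideal[of F 1]
      module.subspace_scale[OF module_times, of "weight_ideal F 1"]
    unfolding prime_ideal_def by (metis mult.commute)
  then have PX: "P = (\<Inter>F\<in>X. weight_ideal F 1)"
    by (auto simp: P(2) cover_ideal_eq X_def)
  then obtain F where F: "F \<in> X" "weight_ideal F 1 \<subseteq> P"
    using prime_ideal_Inter_subset[of X P "\<lambda>F. weight_ideal F 1"] P(1) is_ideal_weight_ideal
    by auto
  then have "P = weight_ideal F 1" using PX by blast
  then show "P \<in> (\<lambda>F. weight_ideal F 1) ` bases \<Delta>"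
    using F(1) by (auto simp: X_def)
next
  fix P :: "('v, 'k) mpoly set"
  assume "P \<in> (\<lambda>F. weight_ideal F 1) ` bases \<Delta>"
  then obtain F where F: "F \<in> bases \<Delta>" "P = weight_ideal F 1" by auto
  \<comment> \<open>The product of the variables outside \<open>F\<close>. Any other basis is not
    contained in \<open>F\<close>, so its prime contains this product, whereas the prime of
    \<open>F\<close> does not. The annihilator is therefore the prime of \<open>F\<close>.\<close>
  let ?f = "Poly_Mapping.single (set_monomial (- F)) 1 :: ('v, 'k) mpoly"
  have "1 \<le> card (G \<inter> - F) \<longleftrightarrow> G \<noteq> F" if "G \<in> bases \<Delta>" for G
  proof -
    have "G \<subseteq> F \<longleftrightarrow> G = F"
      using that F(1) unfolding bases_def by blast
    moreover have "1 \<le> card (G \<inter> - F) \<longleftrightarrow> G \<inter> - F \<noteq> {}"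
      by (simp add: Suc_le_eq card_gt_0_iff)
    ultimately show ?thesis by blast
  qed
  moreover have "r * ?f \<in> cover_ideal \<Delta> \<longleftrightarrow>
      (\<forall>G\<in>bases \<Delta>. \<forall>m\<in>Poly_Mapping.keys r. 1 \<le> weight m G + card (G \<inter> - F))" for r
    by (simp add: cover_ideal_eq weight_ideal_def keys_times_monomial weight_add weight_set_monomial)
  moreover have "card (F \<inter> - F) = 0" by simp
  ultimately have "r * ?f \<in> cover_ideal \<Delta> \<longleftrightarrow> r \<in> weight_ideal F 1" for r
    using F(1) trans_le_add2 unfolding weight_ideal_def mem_Collect_eq by (metis add_0_right)
  then show "P \<in> associated_primes (cover_ideal \<Delta>)"
    using F(2) prime_weight_ideal unfolding associated_primes_def by blast
qed

text \<open>By the description of the associated primes, each symbolic power is an intersection of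
  weight ideals. From here on only exponent vectors and covers matter.\<close>

lemma symbolic_rees_cover_ideal:
  fixes p :: "('v::finite, 'k::idom) mpoly poly"
  shows "p \<in> symbolic_rees (cover_ideal \<Delta>) \<longleftrightarrow>
    (\<forall>l. \<forall>m\<in>Poly_Mapping.keys (coeff p l). is_cover \<Delta> l m)"
proof -
  have "symbolic_power (cover_ideal \<Delta>) l = (\<Inter>F\<in>bases \<Delta>. weight_ideal F l :: ('v, 'k) mpoly set)" for l
    by (simp add: symbolic_power_def associated_primes_cover_ideal ideal_power_weight_ideal
        del: One_nat_def)
  then show ?thesis
    by (auto simp: symbolic_rees_def weight_ideal_def is_cover_def)
qed

lemma is_cover_add: "is_cover \<Delta> a m \<Longrightarrow> is_cover \<Delta> b n \<Longrightarrow> is_cover \<Delta> (a + b) (m + n)"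
  by (auto simp: is_cover_def weight_add intro: add_mono)

lemma keys_coeff_mult:
  fixes p q :: "('v, 'k::comm_ring_1) mpoly poly"
  assumes "k \<in> Poly_Mapping.keys (coeff (p * q) l)"
  obtains a b m n where "a + b = l" "m + n = k"
    "m \<in> Poly_Mapping.keys (coeff p a)" "n \<in> Poly_Mapping.keys (coeff q b)"
proof -
  have "k \<in> Poly_Mapping.keys (\<Sum>i\<le>l. coeff p i * coeff q (l - i))"
    using assms by (simp add: coeff_mult)
  then obtain i where i: "i \<le> l" "k \<in> Poly_Mapping.keys (coeff p i * coeff q (l - i))"
    using keys_sum[of "\<lambda>i. coeff p i * coeff q (l - i)" "{..l}"] by auto
  then obtain m n where "m + n = k" "m \<in> Poly_Mapping.keys (coeff p i)"
    "n \<in> Poly_Mapping.keys (coeff q (l - i))"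
    using keys_mult by blast
  then show thesis using that[of i "l - i" m n] i(1) by simp
qed

lemma algebra_gen_subset_symbolic_rees:
  fixes S :: "('v::finite, 'k::idom) mpoly poly set"
  assumes "S \<subseteq> symbolic_rees (cover_ideal \<Delta>)"
  shows "algebra_gen S \<subseteq> symbolic_rees (cover_ideal \<Delta>)"
proof
  fix p
  assume "p \<in> algebra_gen S"
  then show "p \<in> symbolic_rees (cover_ideal \<Delta>)"
  proof (induction rule: algebra_gen.induct)
    case (const r)
    then show ?case
      by (auto simp: symbolic_rees_cover_ideal coeff_pCons is_cover_def split: nat.splits)
  next
    case (gen p)
    then show ?case using assms by blast
  next
    case (add p q)
    then show ?case
      unfolding symbolic_rees_cover_ideal coeff_add by (meson Un_iff keys_add subsetD)
  next
    case (mult p q)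
    have "is_cover \<Delta> l k" if k: "k \<in> Poly_Mapping.keys (coeff (p * q) l)" for l k
    proof -
      obtain a b m n where split: "a + b = l" "m + n = k"
        and "m \<in> Poly_Mapping.keys (coeff p a)" "n \<in> Poly_Mapping.keys (coeff q b)"
        using k by (rule keys_coeff_mult)
      then have "is_cover \<Delta> a m" "is_cover \<Delta> b n"
        using mult.IH by (simp_all add: symbolic_rees_cover_ideal)
      then show ?thesis using is_cover_add split by blast
    qed
    then show ?case by (simp add: symbolic_rees_cover_ideal)
  qed
qed

section \<open>Upper bound: generation in low degree\<close>

lemma algebra_gen_sum:
  assumes "\<And>x. x \<in> X \<Longrightarrow> f x \<in> algebra_gen S"
  shows "sum f X \<in> algebra_gen S"
  using assms
proof (induction X rule: infinite_finite_induct)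
  case (insert x X)
  then show ?case by (simp add: algebra_gen.add)
qed (use algebra_gen.const[of 0 S] in simp_all)

lemma algebra_gen_if_monomials:
  fixes p :: "('v, 'k::comm_ring_1) mpoly poly"
  assumes "\<And>l m c. m \<in> Poly_Mapping.keys (coeff p l) \<Longrightarrow>
    monom (Poly_Mapping.single m c) l \<in> algebra_gen S"
  shows "p \<in> algebra_gen S"
proof -
  have monom_sum: "monom (sum f X) l = (\<Sum>x\<in>X. monom (f x) l)"
    for f :: "('v \<Rightarrow>\<^sub>0 nat) \<Rightarrow> ('v, 'k) mpoly" and X l
    by (induction X rule: infinite_finite_induct) (simp_all add: add_monom[symmetric])
  have "monom (coeff p l) l \<in> algebra_gen S" for l
    by (subst mpoly_eq_sum_monomials[symmetric], unfold monom_sum)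
      (intro algebra_gen_sum assms)
  then have "(\<Sum>l\<le>degree p. monom (coeff p l) l) \<in> algebra_gen S"
    by (intro algebra_gen_sum)
  then show ?thesis by (simp add: poly_as_sum_of_monoms)
qed

text \<open>The induction runs on the total degree of \<open>m\<close> and not on \<open>l\<close>,
  because the factor peeled off may have \<open>a = 0\<close>, in which case \<open>l\<close> does
  not drop.\<close>

lemma monomial_in_algebra_gen:
  fixes A :: "'i \<Rightarrow> 'v::finite set" and c :: "'k::idom"
  assumes mat: "matroid UNIV \<Delta>"
    and rank: "\<And>i F. i \<in> I \<Longrightarrow> F \<in> bases \<Delta> \<Longrightarrow> card (F \<inter> A i) = r i"
    and bound: "\<And>i. i \<in> I \<Longrightarrow> r i \<le> d"
    and ground: "(\<Union>i\<in>I. A i) = UNIV"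
    and cover: "is_cover \<Delta> l m"
  shows "monom (Poly_Mapping.single m c) l
    \<in> algebra_gen {p \<in> symbolic_rees (cover_ideal \<Delta>). degree p \<le> d}"
    (is "_ \<in> algebra_gen ?S")
  using cover
proof (induction "weight m UNIV" arbitrary: l m rule: less_induct)
  case less
  interpret matroid UNIV \<Delta> by (rule mat)
  have small: "monom (Poly_Mapping.single n c) b \<in> algebra_gen ?S"
    if "is_cover \<Delta> b n" "b \<le> d" for n b and c :: 'k
  proof (rule algebra_gen.gen)
    have "degree (monom (Poly_Mapping.single n c) b) \<le> d"
      using degree_monom_le that(2) by (rule le_trans)
    then show "monom (Poly_Mapping.single n c) b \<in> ?S"
      using that(1) by (auto simp: symbolic_rees_cover_ideal coeff_monom split: if_splits)
  qed
  show ?case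
  proof (cases "l \<le> d")
    case True
    then show ?thesis using small less.prems by blast
  next
    case False
    \<comment> \<open>Since \<open>l > d\<close>, the cover \<open>m\<close> is nonzero and involves
      some variable \<open>v\<close>. Peeling in a block \<open>A i\<close> that contains
      \<open>v\<close> makes \<open>U\<close> nonempty, so the total degree really
      decreases.\<close>
    obtain F where "F \<in> bases \<Delta>" using bases_nonempty by auto
    then have "Suc 0 \<le> weight m F" using less.prems False by (force simp: is_cover_def)
    then obtain v n where "m = Poly_Mapping.single v 1 + n"
      by (rule weight_Suc_split)
    then have v: "0 < Poly_Mapping.lookup m v" by (simp add: lookup_add)
    obtain i where i: "i \<in> I" "v \<in> A i" using ground by blast
    define U where "U = {v \<in> A i. 0 < Poly_Mapping.lookup m v}"
    obtain a where a: "a \<le> r i" "\<And>F. F \<in> bases \<Delta> \<Longrightarrow> a \<le> card (F \<inter> U)"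
      "\<And>F. F \<in> bases \<Delta> \<Longrightarrow> l - a \<le> (\<Sum>v\<in>F. Poly_Mapping.lookup m v - of_bool (v \<in> U))"
      using cover_peel[of "A i" "r i" l "Poly_Mapping.lookup m"] rank[OF i(1)] less.prems
      unfolding is_cover_def weight_def U_def by blast
    let ?m' = "m - set_monomial U"
    have m: "m = ?m' + set_monomial U"
      by (rule poly_mapping_eqI) (auto simp: lookup_add lookup_minus lookup_set_monomial U_def)
    have "is_cover \<Delta> a (set_monomial U)"
      using a(2) by (simp add: is_cover_def weight_set_monomial)
    moreover have "a \<le> d" using a(1) bound[OF i(1)] by simp
    ultimately have "monom (Poly_Mapping.single (set_monomial U) 1) a \<in> algebra_gen ?S"
      by (rule small)
    moreover have "monom (Poly_Mapping.single ?m' c) (l - a) \<in> algebra_gen ?S"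
    proof (rule less.hyps)
      have "0 < card (UNIV \<inter> U)" using v i(2) by (auto simp: U_def card_gt_0_iff)
      then show "weight ?m' UNIV < weight m UNIV"
        by (subst (2) m) (simp add: weight_add weight_set_monomial)
      show "is_cover \<Delta> (l - a) ?m'"
        using a(3) by (simp add: is_cover_def weight_def lookup_minus lookup_set_monomial)
    qed
    moreover have "monom (Poly_Mapping.single m c) l
        = monom (Poly_Mapping.single ?m' c) (l - a) * monom (Poly_Mapping.single (set_monomial U) 1) a"
      using False \<open>a \<le> d\<close> m by (simp add: mult_monom mult_single)
    ultimately show ?thesis by (simp add: algebra_gen.mult)
  qed
qed

lemma symbolic_rees_generated:
  fixes A :: "'i \<Rightarrow> 'v::finite set"
  assumes "matroid UNIV \<Delta>"
    and "\<And>i F. i \<in> I \<Longrightarrow> F \<in> bases \<Delta> \<Longrightarrow> card (F \<inter> A i) = r i"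
    and "\<And>i. i \<in> I \<Longrightarrow> r i \<le> d"
    and "(\<Union>i\<in>I. A i) = UNIV"
  shows "algebra_gen {p \<in> symbolic_rees (cover_ideal \<Delta> :: ('v, 'k::idom) mpoly set). degree p \<le> d}
    = symbolic_rees (cover_ideal \<Delta>)"
proof
  show "algebra_gen {p \<in> symbolic_rees (cover_ideal \<Delta> :: ('v, 'k) mpoly set). degree p \<le> d}
      \<subseteq> symbolic_rees (cover_ideal \<Delta>)"
    by (intro algebra_gen_subset_symbolic_rees) auto
  show "symbolic_rees (cover_ideal \<Delta> :: ('v, 'k) mpoly set)
      \<subseteq> algebra_gen {p \<in> symbolic_rees (cover_ideal \<Delta>). degree p \<le> d}"
  proof
    fix p :: "('v, 'k) mpoly poly"
    assume p: "p \<in> symbolic_rees (cover_ideal \<Delta>)"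
    show "p \<in> algebra_gen {p \<in> symbolic_rees (cover_ideal \<Delta>). degree p \<le> d}"
    proof (rule algebra_gen_if_monomials)
      fix l m and c :: 'k
      assume "m \<in> Poly_Mapping.keys (coeff p l)"
      then have cover: "is_cover \<Delta> l m" using p by (simp add: symbolic_rees_cover_ideal)
      show "monom (Poly_Mapping.single m c) l
          \<in> algebra_gen {p \<in> symbolic_rees (cover_ideal \<Delta>). degree p \<le> d}"
        by (rule monomial_in_algebra_gen[OF assms(1) _ _ assms(4) cover]) (use assms(2,3) in auto)
    qed
  qed
qed

section \<open>Lower bound: the indecomposable monomials of the components\<close>

lemma direct_sum_family_bases:
  assumes sum: "is_direct_sum_family E \<Delta> I A D" and i: "i \<in> I"
  shows "(\<lambda>F. F \<inter> A i) ` bases \<Delta> = bases (D i)"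
proof -
  have mat: "matroid (A j) (D j)" if "j \<in> I" for j
    using sum that by (simp add: is_direct_sum_family_def)
  have disj: "A j \<inter> A i = {}" if "j \<in> I" "j \<noteq> i" for j
    using sum that i by (auto simp: is_direct_sum_family_def disjoint_family_on_def)
  have bases: "bases \<Delta> = {(\<Union>i\<in>I. F i) | F. \<forall>i\<in>I. F i \<in> bases (D i)}"
    using sum by (simp add: is_direct_sum_family_def)
  have meet: "(\<Union>j\<in>I. F j) \<inter> A i = F i" if F: "\<forall>j\<in>I. F j \<in> bases (D j)" for F
  proof -
    have "F j \<subseteq> A j" if "j \<in> I" for j
      using F that mat matroid.basis_face matroid.face_ground by metis
    then show ?thesis using disj i by blast
  qed
  have "G \<in> (\<lambda>F. F \<inter> A i) ` bases \<Delta>" if G: "G \<in> bases (D i)" for G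
  proof -
    \<comment> \<open>A basis \<open>G\<close> of the component \<open>i\<close> is completed by
      arbitrary bases of all other components.\<close>
    define F where "F j = (if j = i then G else SOME B. B \<in> bases (D j))" for j
    have "F j \<in> bases (D j)" if "j \<in> I" for j
      using G matroid.bases_nonempty[OF mat[OF that]] by (auto simp: F_def some_in_eq)
    then have "(\<Union>j\<in>I. F j) \<in> bases \<Delta>" "(\<Union>j\<in>I. F j) \<inter> A i = F i"
      using meet bases by auto
    moreover have "F i = G" by (simp add: F_def)
    ultimately show ?thesis by (metis imageI)
  qed
  moreover have "F \<inter> A i \<in> bases (D i)" if "F \<in> bases \<Delta>" for F
    using that meet i unfolding bases by auto
  ultimately show ?thesis by blast
qed

text \<open>The exponents of the sum are 0 or 1, so \<open>m\<^sub>1\<close> and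
  \<open>m\<^sub>2\<close> are the indicator vectors of two complementary subsets of
  \<open>A i\<close>. Their weights on bases become intersection sizes, and
  \<open>connected_cover_trivial\<close> applies.\<close>

lemma component_cover_indecomposable:
  fixes A :: "'i \<Rightarrow> 'v::finite set"
  assumes comps: "connected_components UNIV \<Delta> I A D" and i: "i \<in> I"
    and cover1: "is_cover \<Delta> l\<^sub>1 m\<^sub>1" and cover2: "is_cover \<Delta> l\<^sub>2 m\<^sub>2"
    and m: "m\<^sub>1 + m\<^sub>2 = set_monomial (A i)" and l: "l\<^sub>1 + l\<^sub>2 = matroid_rank (D i)"
  shows "m\<^sub>1 = 0 \<or> m\<^sub>2 = 0"
proof -
  have sum: "is_direct_sum_family UNIV \<Delta> I A D" and conn: "connected_matroid (A i) (D i)"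
    using comps i by (auto simp: connected_components_def)
  interpret matroid "A i" "D i" using conn by (simp add: connected_matroid_def)
  let ?supp = "\<lambda>m. {v. Poly_Mapping.lookup m v \<noteq> 0}"
  have pointwise: "Poly_Mapping.lookup m\<^sub>1 v + Poly_Mapping.lookup m\<^sub>2 v = of_bool (v \<in> A i)" for v
    by (metis m lookup_add lookup_set_monomial finite)
  have "\<not> (Poly_Mapping.lookup m\<^sub>1 v \<noteq> 0 \<and> Poly_Mapping.lookup m\<^sub>2 v \<noteq> 0)"
    "(Poly_Mapping.lookup m\<^sub>1 v \<noteq> 0 \<or> Poly_Mapping.lookup m\<^sub>2 v \<noteq> 0) = (v \<in> A i)" for v
    using pointwise[of v] by (cases "v \<in> A i"; simp; linarith)+
  then have part: "?supp m\<^sub>1 \<inter> ?supp m\<^sub>2 = {}" "?supp m\<^sub>1 \<union> ?supp m\<^sub>2 = A i"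
    by blast+
  have card_ge: "l \<le> card (G \<inter> ?supp n)"
    if cover: "is_cover \<Delta> l n" and le: "\<And>v. Poly_Mapping.lookup n v \<le> of_bool (v \<in> A i)"
      and G: "G \<in> bases (D i)" for l n G
  proof -
    have n: "n = set_monomial (?supp n)"
    proof (rule poly_mapping_eqI)
      fix v
      show "Poly_Mapping.lookup n v = Poly_Mapping.lookup (set_monomial (?supp n)) v"
        using le[of v] by (cases "v \<in> A i") (auto simp: lookup_set_monomial)
    qed
    obtain F where F: "F \<in> bases \<Delta>" "G = F \<inter> A i"
      using G direct_sum_family_bases[OF sum i] by auto
    have "?supp n \<subseteq> A i"
    proof
      fix v
      assume "v \<in> ?supp n"
      then show "v \<in> A i" using le[of v] by (cases "v \<in> A i") simp_all
    qed
    then have "G \<inter> ?supp n = F \<inter> ?supp n" using F by blast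
    then show ?thesis
      using cover F(1) weight_set_monomial[of "?supp n" F] n
      unfolding is_cover_def by (metis finite)
  qed
  have "?supp m\<^sub>1 = {} \<or> ?supp m\<^sub>2 = {}"
  proof (rule connected_cover_trivial[OF conn part _ _ l])
    show "l\<^sub>1 \<le> card (G \<inter> ?supp m\<^sub>1)" if "G \<in> bases (D i)" for G
      using card_ge[OF cover1 _ that] pointwise by (metis le_add1)
    show "l\<^sub>2 \<le> card (G \<inter> ?supp m\<^sub>2)" if "G \<in> bases (D i)" for G
      using card_ge[OF cover2 _ that] pointwise by (metis le_add2)
  qed
  then show ?thesis by (auto intro: poly_mapping_eqI)
qed

text \<open>If \<open>d\<close> were smaller than the rank, the monomial of \<open>A i\<close> in
  degree \<open>?r\<close> would be absent from constants and generators. Sums and products preserve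
  this absence, although the monomial belongs to the symbolic Rees algebra.\<close>

lemma component_rank_le_generator_degree:
  fixes A :: "'i \<Rightarrow> 'v::finite set" and S :: "('v, 'k::idom) mpoly poly set"
  assumes mat: "matroid UNIV \<Delta>"
    and comps: "connected_components UNIV \<Delta> I A D" and i: "i \<in> I"
    and S: "S \<subseteq> symbolic_rees (cover_ideal \<Delta>)" "\<And>p. p \<in> S \<Longrightarrow> degree p \<le> d"
    and gen: "algebra_gen S = symbolic_rees (cover_ideal \<Delta>)"
  shows "matroid_rank (D i) \<le> d"
proof (rule ccontr)
  let ?r = "matroid_rank (D i)" and ?m = "set_monomial (A i)"
  assume less: "\<not> ?r \<le> d"
  interpret matroid UNIV \<Delta> by (rule mat)
  have sum: "is_direct_sum_family UNIV \<Delta> I A D"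
    using comps by (simp add: connected_components_def)
  have "matroid (A i) (D i)" using sum i by (simp add: is_direct_sum_family_def)
  then have "is_cover \<Delta> ?r ?m"
    using direct_sum_family_bases[OF sum i] matroid.matroid_rank_eq_card
    unfolding is_cover_def by (metis finite imageI order_refl weight_set_monomial)
  then have "monom (Poly_Mapping.single ?m 1) ?r \<in> algebra_gen S"
    unfolding gen by (simp add: symbolic_rees_cover_ideal coeff_monom)
  moreover have "?m \<notin> Poly_Mapping.keys (coeff p ?r)" if "p \<in> algebra_gen S" for p
    using that
  proof (induction rule: algebra_gen.induct)
    case (const c)
    then show ?case using less by (simp add: coeff_pCons split: nat.splits)
  next
    case (gen p)
    then show ?case using S(2) less by (force simp: coeff_eq_0)
  next
    case (add p q)
    then show ?case using keys_add by fastforce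
  next
    case (mult p q)
    show ?case
    proof
      assume "?m \<in> Poly_Mapping.keys (coeff (p * q) ?r)"
      then obtain a b m n where split: "a + b = ?r" "m + n = ?m"
        and keys: "m \<in> Poly_Mapping.keys (coeff p a)" "n \<in> Poly_Mapping.keys (coeff q b)"
        by (rule keys_coeff_mult)
      have cover: "is_cover \<Delta> a m" "is_cover \<Delta> b n"
        using mult.hyps keys gen by (auto simp: symbolic_rees_cover_ideal)
      have "m = 0 \<or> n = 0"
        using component_cover_indecomposable[OF comps i cover split(2,1)] .
      \<comment> \<open>The zero exponent covers only in degree 0. A trivial factor thus also has
        \<open>t\<close>-degree 0, and the other factor would contain the whole monomial in degree
        \<open>?r\<close>, against the induction hypothesis.\<close>
      moreover have "c = 0" if "is_cover \<Delta> c 0" for c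
        using that bases_nonempty by (auto simp: is_cover_def)
      ultimately have "(m = 0 \<and> a = 0) \<or> (n = 0 \<and> b = 0)"
        using cover by blast
      then show False
        using split keys mult.IH by auto
    qed
  qed
  ultimately show False by fastforce
qed

theorem theorem4p7:
  fixes \<Delta> :: "'n::finite set set"
    and d :: nat
    and A :: "nat \<Rightarrow> 'n set"
    and D :: "nat \<Rightarrow> 'n set set"
    and J :: "('n, 'k::field) mpoly set"
  assumes matroid: "matroid UNIV \<Delta>"
    and components: "connected_components UNIV \<Delta> {1..d} A D"
    and J: "J = cover_ideal \<Delta>"
  shows "symbolic_noether_number J = Max {matroid_rank (D i) | i. i \<in> {1..d}}"
proof -
  let ?R = "{matroid_rank (D i) | i. i \<in> {1..d}}"
  let ?gen = "\<lambda>e. \<exists>S \<subseteq> symbolic_rees J. (\<forall>p\<in>S. degree p \<le> e) \<and> algebra_gen S = symbolic_rees J"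
  have sum: "is_direct_sum_family UNIV \<Delta> {1..d} A D"
    using components by (simp add: connected_components_def)
  have ground: "(\<Union>i\<in>{1..d}. A i) = UNIV"
    using sum by (simp add: is_direct_sum_family_def)
  \<comment> \<open>The type of variables is nonempty, so at least one component exists and the
    maximum is taken over a nonempty set.\<close>
  have "{1..d} \<noteq> {}"
    using ground by (metis UN_empty UNIV_not_empty)
  then have R: "finite ?R" "?R \<noteq> {}"
    by auto
  have rank: "card (F \<inter> A i) = matroid_rank (D i)" if "i \<in> {1..d}" "F \<in> bases \<Delta>" for i F
  proof -
    have "matroid (A i) (D i)" using sum that(1) by (simp add: is_direct_sum_family_def)
    moreover have "F \<inter> A i \<in> bases (D i)" using direct_sum_family_bases[OF sum that(1)] that(2) by auto
    ultimately show ?thesis by (simp add: matroid.matroid_rank_eq_card)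
  qed
  have le: "matroid_rank (D i) \<le> Max ?R" if "i \<in> {1..d}" for i
    using R(1) that by (intro Max_ge) auto
  have "algebra_gen {p \<in> symbolic_rees J. degree p \<le> Max ?R} = symbolic_rees J"
    unfolding J using symbolic_rees_generated[OF matroid rank le ground] .
  then have "?gen (Max ?R)"
    by (intro exI[of _ "{p \<in> symbolic_rees J. degree p \<le> Max ?R}"]) auto
  moreover have "Max ?R \<le> e" if "?gen e" for e
    using that component_rank_le_generator_degree[OF matroid components] R
    unfolding J by (subst Max_le_iff) blast+
  ultimately show ?thesis
    unfolding symbolic_noether_number_def by (rule Least_equality)
qed

end
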